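(* Let $k \geq 1$ be an integer and let $G$ be a graph whose fractional arboricity satisfies $\Upsilon_f(G) \leq k + \frac{1}{3k+2}$. Then $E(G)$ can be decomposed into $k$ forests and a matching; that is, $E(G)$ can be partitioned into $k+1$ (possibly empty) sets $F_1,\dots,F_k,M$ such that each $F_i$ is the edge set of a forest in $G$ and $M$ is a matching of $G$.
   Context: Graphs are finite and may contain loops and parallel edges. $V(H)$ and $E(H)$ denote the vertex set and edge set of a graph $H$. The fractional arboricity of a graph $G$ is $\Upsilon_f(G) = \max_{H \subseteq G} \frac{|E(H)|}{|V(H)|-1}$, the maximum being over all subgraphs $H$ of $G$. Conventions for the degenerate case $|V(H)|=1$: a one-vertex subgraph without edges is disregarded (contributes $0$), and a one-vertex subgraph with a loop contributes $+\infty$; thus a graph with finite fractional arboricity has no loops. A forest is a graph without cycles (two parallel edges form a cycle of length 2). A matching of $G$ is a set of non-loop edges of $G$, no two of which share an endvertex. *)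

theory Defs
  imports Complex_Main "HOL-Library.Extended_Real" "HOL-Library.Disjoint_Sets"
begin

text \<open>
  The map \<open>ends\<close> sends an edge to its set of endvertices: a singleton for a loop, a two-element
  set otherwise. Parallel edges are distinct edges with the same image. Its values
  outside \<open>edges G\<close> are irrelevant.
\<close>

record ('v, 'e) multigraph =
  verts :: "'v set"
  edges :: "'e set"
  ends :: "'e \<Rightarrow> 'v set"

locale finite_multigraph =
  fixes G :: "('v, 'e) multigraph"
  assumes finite_verts: "finite (verts G)"
    and finite_edges: "finite (edges G)"
    and ends_subset: "e \<in> edges G \<Longrightarrow> ends G e \<subseteq> verts G"
    and card_ends: "e \<in> edges G \<Longrightarrow> card (ends G e) \<in> {1, 2}"

text \<open>
  Requiring \<open>ends H = ends G\<close> as total functions, and not only on \<open>edges H\<close>, makes a subgraph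
  determined by its vertex and edge set; in particular a finite graph has finitely many subgraphs.
\<close>

definition subgraph :: "('v, 'e) multigraph \<Rightarrow> ('v, 'e) multigraph \<Rightarrow> bool" where
  "subgraph H G \<longleftrightarrow> finite_multigraph H \<and>
     verts H \<subseteq> verts G \<and> edges H \<subseteq> edges G \<and> ends H = ends G"

text \<open>
  On at most one vertex every edge is a loop, whence the value \<open>\<infinity>\<close>. The graph without vertices is
  admitted as a subgraph; like a single vertex without edges it contributes \<open>0\<close>.
\<close>

definition density :: "('v, 'e) multigraph \<Rightarrow> ereal" where
  "density H =
     (if card (verts H) \<le> 1 then (if edges H = {} then 0 else \<infinity>)
      else ereal (real (card (edges H)) / (real (card (verts H)) - 1)))"

definition fractional_arboricity :: "('v, 'e) multigraph \<Rightarrow> ereal" where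
  "fractional_arboricity G = Max (density ` {H. subgraph H G})"

text \<open>
  The cycle through \<open>vs ! 0, es ! 0, vs ! 1, es ! 1, \<dots>\<close> and back to \<open>vs ! 0\<close>. A loop is a cycle
  of length 1. The requirement \<open>distinct es\<close> matters for length 2 only: it rules out traversing
  one edge back and forth.
\<close>

definition is_cycle :: "('v, 'e) multigraph \<Rightarrow> 'v list \<Rightarrow> 'e list \<Rightarrow> bool" where
  "is_cycle G vs es \<longleftrightarrow>
     vs \<noteq> [] \<and> length es = length vs \<and> distinct vs \<and> distinct es \<and>
     set vs \<subseteq> verts G \<and> set es \<subseteq> edges G \<and>
     (\<forall>i < length vs. ends G (es ! i) = {vs ! i, vs ! (Suc i mod length vs)})"

definition forest :: "('v, 'e) multigraph \<Rightarrow> bool" where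
  "forest H \<longleftrightarrow> finite_multigraph H \<and> (\<nexists>vs es. is_cycle H vs es)"

definition forest_edge_set :: "('v, 'e) multigraph \<Rightarrow> 'e set \<Rightarrow> bool" where
  "forest_edge_set G F \<longleftrightarrow> (\<exists>H. subgraph H G \<and> forest H \<and> edges H = F)"

definition matching :: "('v, 'e) multigraph \<Rightarrow> 'e set \<Rightarrow> bool" where
  "matching G M \<longleftrightarrow> M \<subseteq> edges G \<and> (\<forall>e\<in>M. card (ends G e) \<noteq> 1) \<and>
     (\<forall>e\<in>M. \<forall>f\<in>M. e \<noteq> f \<longrightarrow> ends G e \<inter> ends G f = {})"

lemma finite_subgraphs:
  assumes "finite_multigraph G"
  shows "finite {H. subgraph H G}"
proof (rule finite_subset)
  show "{H. subgraph H G} \<subseteq>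
    (\<lambda>(V, E). \<lparr>verts = V, edges = E, ends = ends G\<rparr>) ` (Pow (verts G) \<times> Pow (edges G))"
  proof
    fix H assume "H \<in> {H. subgraph H G}"
    then have H: "verts H \<subseteq> verts G" "edges H \<subseteq> edges G" "ends H = ends G"
      by (auto simp: subgraph_def)
    then have "H = (\<lambda>(V, E). \<lparr>verts = V, edges = E, ends = ends G\<rparr>) (verts H, edges H)"
      by simp
    with H show "H \<in> (\<lambda>(V, E). \<lparr>verts = V, edges = E, ends = ends G\<rparr>) `
      (Pow (verts G) \<times> Pow (edges G))" by blast
  qed
  show "finite ((\<lambda>(V, E). \<lparr>verts = V, edges = E, ends = ends G\<rparr>) `
    (Pow (verts G) \<times> Pow (edges G)))"
    using assms by (simp add: finite_multigraph_def)
qed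

lemma subgraph_refl: "finite_multigraph G \<Longrightarrow> subgraph G G"
  by (simp add: subgraph_def)

end

theory Submission
  imports Defs
begin

text \<open>
  Write \<open>B[X]\<close> for the edges of \<open>B\<close> with both ends in the vertex set \<open>X\<close>. Every cycle-free edge set
  satisfies \<open>|B[X]| \<le> |X| - 1\<close> for all nonempty \<open>X\<close>, so a union \<open>B\<close> of \<open>k\<close> forests is
  \<open>k\<close>-sparse: \<open>|B[X]| \<le> k (|X| - 1)\<close>. Nash-Williams' theorem
  (\<open>sparse_imp_forest_partition\<close>) says that conversely every \<open>k\<close>-sparse set splits into \<open>k\<close> forests.
  Hence it is enough to find a \<open>k\<close>-sparse \<open>B\<close> whose leftover set \<open>F = edges G - B\<close> is a matching.

  All arguments about sparse sets go through tight sets, those \<open>X\<close> with equality above. Counting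
  edges shows that two tight sets that meet have a tight union and a tight intersection, so a set of
  vertices has a least tight superset, its tight hull. If \<open>e\<close> is a leftover edge and \<open>b\<close> lies in the
  tight hull of the ends of \<open>e\<close>, then \<open>B - b + e\<close> is again sparse. Both Nash-Williams'
  theorem and the choice of \<open>B\<close> rest on such swaps.

  Among the \<open>k\<close>-sparse sets with most edges take \<open>B\<close> such that the leftover edges overlap as little
  as possible, measured by \<open>excess\<close>, and suppose that two of them share a vertex \<open>r\<close>. Start with
  the tight set \<open>Z\<^sub>0 = {r}\<close>, and let \<open>Z\<^sub>j\<^sub>+\<^sub>1\<close> be the tight hull of \<open>Z\<^sub>j\<close> together with the leftover
  edges that touch it. Choose \<open>B\<close> so that moreover the sequence of the numbers of leftover edges
  touching \<open>Z\<^sub>0, Z\<^sub>1, \<dots>\<close> is lexicographically least. Call a vertex free if no leftover edge covers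
  it. Two free vertices of \<open>Z\<^sub>j\<^sub>+\<^sub>1 - Z\<^sub>j\<close> are never joined by an edge \<open>b\<close> of \<open>B\<close>: otherwise \<open>b\<close>
  could be swapped with some leftover edge \<open>e\<close> touching \<open>Z\<^sub>j\<close>. As the ends of \<open>b\<close> are free, this
  does not increase the excess; it keeps \<open>Z\<^sub>0, \<dots>, Z\<^sub>j\<close> (\<open>layer_swap\<close>), and it leaves one leftover
  edge fewer touching \<open>Z\<^sub>j\<close>.

  By minimality of the hull each free vertex of \<open>Z\<^sub>j\<^sub>+\<^sub>1 - Z\<^sub>j\<close> has at least \<open>k + 1\<close> edges of \<open>B\<close> inside
  \<open>Z\<^sub>j\<^sub>+\<^sub>1\<close>, and these are distinct for distinct free vertices. Tightness allows only \<open>k\<close> new edges for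
  each new vertex, so each layer has at most \<open>k\<close> times as many free as covered
  vertices (\<open>card_independent_in_hull\<close>). Where the layers become stationary, at a set \<open>X\<close> say, all
  \<open>m\<close> leftover edges touching \<open>X\<close> lie inside \<open>X\<close> and cover at most \<open>2 m\<close> vertices, whence
  \<open>|X| \<le> 2 (k + 1) m - k\<close>. On the other hand \<open>X\<close> is tight, so the bound on the fractional arboricity
  gives \<open>(3 k + 2) m \<le> |X| - 1\<close>, a contradiction.
\<close>

section \<open>Lexicographic minima and increasing chains\<close>

lemma lexicographic_minimum:
  fixes t :: "'c \<Rightarrow> nat \<Rightarrow> nat"
  assumes "S \<noteq> {}"
  shows "\<exists>x\<in>S. \<forall>y\<in>S. \<forall>j<N. (\<forall>i<j. t y i = t x i) \<longrightarrow> t x j \<le> t y j"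
proof (induction N)
  case 0
  then show ?case using assms by blast
next
  case (Suc N)
  then obtain x where x: "x \<in> S"
    "\<And>y j. y \<in> S \<Longrightarrow> j < N \<Longrightarrow> (\<forall>i<j. t y i = t x i) \<Longrightarrow> t x j \<le> t y j" by blast
  let ?P = "\<lambda>y. y \<in> S \<and> (\<forall>i<N. t y i = t x i)"
  have "?P x" using x by simp
  then obtain z where z: "?P z" "\<And>y. ?P y \<Longrightarrow> t z N \<le> t y N"
    using ex_has_least_nat[of ?P x "\<lambda>y. t y N"] by blast
  have "t z j \<le> t y j" if "y \<in> S" "j < Suc N" "\<forall>i<j. t y i = t z i" for y j
  proof (cases "j = N")
    case True
    then show ?thesis using z that by simp
  next
    case False
    then have "j < N" using that by simp
    then show ?thesis using z(1) x(2)[of y j] that by simp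
  qed
  then show ?case using z(1) by blast
qed

lemma increasing_chain_stabilises:
  fixes Z :: "nat \<Rightarrow> 'c set"
  assumes V: "finite V" "\<And>j. Z j \<subseteq> V" and "\<And>j. Z j \<subseteq> Z (Suc j)" and "Z 0 \<noteq> {}"
  shows "\<exists>j\<le>card V. Z (Suc j) = Z j"
proof (rule ccontr)
  assume n: "\<not> ?thesis"
  have fin: "finite (Z j)" for j using V(2) V(1) by (rule finite_subset)
  have "j < card (Z j)" if "j \<le> Suc (card V)" for j
    using that
  proof (induction j)
    case 0
    then show ?case using assms(4) fin by (simp add: card_gt_0_iff)
  next
    case (Suc j)
    then have "Z j \<subset> Z (Suc j)" using n assms(3)[of j] by auto
    then have "card (Z j) < card (Z (Suc j))" by (rule psubset_card_mono[OF fin])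
    then show ?case using Suc by simp
  qed
  from this[of "card V"] card_mono[OF V(1) V(2), of "card V"]
  show False by simp
qed

section \<open>Sparse edge sets and tight vertex sets\<close>

context finite_multigraph
begin

definition induced :: "'e set \<Rightarrow> 'v set \<Rightarrow> 'e set" where
  "induced B X = {b \<in> B. ends G b \<subseteq> X}"

text \<open>
  The inequality \<open>|B[X]| \<le> k (|X| - 1)\<close>, with \<open>k\<close> moved to the left so that no subtraction of natural
  numbers occurs. For \<open>k = 1\<close> this is the counting form of acyclicity.
\<close>

definition sparse :: "nat \<Rightarrow> 'e set \<Rightarrow> bool" where
  "sparse k B \<longleftrightarrow> B \<subseteq> edges G \<and>
     (\<forall>X. X \<subseteq> verts G \<and> X \<noteq> {} \<longrightarrow> card (induced B X) + k \<le> k * card X)"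

definition tight :: "nat \<Rightarrow> 'e set \<Rightarrow> 'v set \<Rightarrow> bool" where
  "tight k B X \<longleftrightarrow> X \<subseteq> verts G \<and> X \<noteq> {} \<and> card (induced B X) + k = k * card X"

definition tight_hull :: "nat \<Rightarrow> 'e set \<Rightarrow> 'v set \<Rightarrow> 'v set" where
  "tight_hull k B W = \<Inter>{T. tight k B T \<and> W \<subseteq> T}"

lemma ends_nonempty: "e \<in> edges G \<Longrightarrow> ends G e \<noteq> {}"
  using card_ends[of e] by auto

lemma finite_ends: "e \<in> edges G \<Longrightarrow> finite (ends G e)"
  using ends_subset finite_verts finite_subset by blast

lemma sparse_subset_edges: "sparse k B \<Longrightarrow> B \<subseteq> edges G"
  by (simp add: sparse_def)

lemma sparse_finite: "sparse k B \<Longrightarrow> finite B"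
  using finite_edges finite_subset sparse_subset_edges by blast

lemma sparseD:
  "sparse k B \<Longrightarrow> X \<subseteq> verts G \<Longrightarrow> X \<noteq> {} \<Longrightarrow> card (induced B X) + k \<le> k * card X"
  by (simp add: sparse_def)

lemma finite_induced: "finite B \<Longrightarrow> finite (induced B X)"
  by (simp add: induced_def)

lemma induced_mono: "A \<subseteq> B \<Longrightarrow> X \<subseteq> Y \<Longrightarrow> induced A X \<subseteq> induced B Y"
  by (auto simp: induced_def)

lemma sparse_mono:
  assumes "sparse k B" "A \<subseteq> B"
  shows "sparse k A"
proof -
  have "card (induced A X) \<le> card (induced B X)" for X
    using assms by (intro card_mono finite_induced induced_mono sparse_finite) auto
  then show ?thesis
    using assms unfolding sparse_def by (meson add_le_mono1 order_trans)
qed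

lemma sparse_empty: "sparse k {}"
  unfolding sparse_def
proof (intro conjI allI impI)
  fix X assume "X \<subseteq> verts G \<and> X \<noteq> {}"
  then have "1 \<le> card X"
    using finite_subset[OF _ finite_verts] by (simp add: Suc_le_eq card_gt_0_iff)
  then show "card (induced {} X) + k \<le> k * card X"
    by (simp add: induced_def)
qed simp

lemma tight_finite: "tight k B X \<Longrightarrow> finite X"
  using finite_verts finite_subset by (auto simp: tight_def)

lemma tight_singleton:
  assumes "sparse k B" "r \<in> verts G"
  shows "tight k B {r}"
  using sparseD[OF assms(1), of "{r}"] assms by (auto simp: tight_def)

text \<open>
  Edge counts are supermodular, with defect the edges that cross between \<open>X - Y\<close> and \<open>Y - X\<close>, and
  vertex counts are modular. Sparsity of \<open>X \<union> Y\<close> and \<open>X \<inter> Y\<close> then leaves no room for a crossing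
  edge. The sets must meet because sparsity says nothing about the empty set.
\<close>

lemma tight_Un_Int:
  assumes B: "sparse k B" and X: "tight k B X" and Y: "tight k B Y" and ne: "X \<inter> Y \<noteq> {}"
  shows "tight k B (X \<union> Y)" "tight k B (X \<inter> Y)"
    "induced B (X \<union> Y) = induced B X \<union> induced B Y"
proof -
  note fin = finite_induced[OF sparse_finite[OF B]]
  have sub: "induced B X \<union> induced B Y \<subseteq> induced B (X \<union> Y)"
    by (auto simp: induced_def)
  have int: "induced B (X \<inter> Y) = induced B X \<inter> induced B Y"
    by (auto simp: induced_def)
  have V: "X \<union> Y \<subseteq> verts G" "X \<union> Y \<noteq> {}" "X \<inter> Y \<subseteq> verts G"
    using X Y by (auto simp: tight_def)
  have le: "card (induced B X \<union> induced B Y) \<le> card (induced B (X \<union> Y))"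
    using sub fin by (rule card_mono[rotated])
  have e1: "card (induced B X) + card (induced B Y)
      = card (induced B X \<union> induced B Y) + card (induced B (X \<inter> Y))"
    unfolding int by (rule card_Un_Int) (rule fin)+
  have e2: "k * card X + k * card Y = k * card (X \<union> Y) + k * card (X \<inter> Y)"
    using card_Un_Int[OF tight_finite[OF X] tight_finite[OF Y]]
    by (simp flip: distrib_left)
  have tx: "card (induced B X) + k = k * card X" "card (induced B Y) + k = k * card Y"
    using X Y by (auto simp: tight_def)
  note s = sparseD[OF B V(1,2)] sparseD[OF B V(3) ne]
  show "tight k B (X \<union> Y)"
    using V le e1 e2 tx s by (simp add: tight_def)
  show "tight k B (X \<inter> Y)"
    using V ne le e1 e2 tx s by (simp add: tight_def)
  have "card (induced B X \<union> induced B Y) = card (induced B (X \<union> Y))"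
    using le e1 e2 tx s by linarith
  then show "induced B (X \<union> Y) = induced B X \<union> induced B Y"
    using card_subset_eq[OF fin sub] by simp
qed

lemma tight_Un_Union:
  assumes B: "sparse k B" and Z: "tight k B Z" and "finite \<T>"
    and "\<And>T. T \<in> \<T> \<Longrightarrow> tight k B T \<and> T \<inter> Z \<noteq> {}"
  shows "tight k B (Z \<union> \<Union>\<T>) \<and>
    induced B (Z \<union> \<Union>\<T>) = induced B Z \<union> (\<Union>T\<in>\<T>. induced B T)"
  using assms(3,4)
proof (induction \<T> rule: finite_induct)
  case empty
  then show ?case using Z by simp
next
  case (insert T \<T>)
  then have IH: "tight k B (Z \<union> \<Union>\<T>)"
    "induced B (Z \<union> \<Union>\<T>) = induced B Z \<union> (\<Union>T\<in>\<T>. induced B T)"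
    and T: "tight k B T" "T \<inter> Z \<noteq> {}" by auto
  have ne: "(Z \<union> \<Union>\<T>) \<inter> T \<noteq> {}" using T by auto
  have eq: "Z \<union> \<Union>(insert T \<T>) = (Z \<union> \<Union>\<T>) \<union> T" by auto
  show ?case
    using tight_Un_Int[OF B IH(1) T(1) ne] IH(2) unfolding eq by auto
qed

lemma tight_hull_is_tight:
  assumes B: "sparse k B" and T: "tight k B T" "W \<subseteq> T" and W: "W \<noteq> {}"
  shows "tight k B (tight_hull k B W)"
proof -
  have "tight k B (\<Inter>\<T>)" if "finite \<T>" "\<T> \<noteq> {}" "\<T> \<subseteq> {T. tight k B T \<and> W \<subseteq> T}" for \<T>
    using that
  proof (induction \<T> rule: finite_ne_induct)
    case (singleton x)
    then show ?case by simp
  next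
    case (insert x F)
    then have "tight k B x" "tight k B (\<Inter>F)" by auto
    moreover have "W \<subseteq> x \<inter> \<Inter>F" using insert.prems by auto
    then have "x \<inter> \<Inter>F \<noteq> {}" using W by blast
    ultimately show ?case using tight_Un_Int(2)[OF B] by simp
  qed
  moreover have "finite {T. tight k B T \<and> W \<subseteq> T}"
    by (rule finite_subset[of _ "Pow (verts G)"]) (auto simp: tight_def finite_verts)
  ultimately show ?thesis using T unfolding tight_hull_def by blast
qed

lemma subset_tight_hull: "W \<subseteq> tight_hull k B W"
  by (auto simp: tight_hull_def)

lemma tight_hull_least: "tight k B T \<Longrightarrow> W \<subseteq> T \<Longrightarrow> tight_hull k B W \<subseteq> T"
  by (auto simp: tight_hull_def)

text \<open>
  If \<open>v\<close> had at most \<open>k\<close> edges in the hull, then removing it would leave a smaller tight set.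
\<close>

lemma degree_in_hull:
  assumes B: "sparse k B" and t: "tight k B (tight_hull k B W)" and "W \<noteq> {}"
    and v: "v \<in> tight_hull k B W" "v \<notin> W"
  shows "k + 1 \<le> card {b \<in> induced B (tight_hull k B W). v \<in> ends G b}"
proof -
  let ?H = "tight_hull k B W"
  let ?S = "{b \<in> induced B ?H. v \<in> ends G b}"
  have W: "W \<subseteq> ?H - {v}" "?H - {v} \<noteq> {}" using subset_tight_hull[of W k B] assms by auto
  have V: "?H - {v} \<subseteq> verts G" using t by (auto simp: tight_def)
  have nt: "\<not> tight k B (?H - {v})" using tight_hull_least[of k B "?H - {v}" W] W v by auto
  have le: "card (induced B (?H - {v})) + k < k * card (?H - {v})"
    using sparseD[OF B V W(2)] nt V W by (auto simp: tight_def)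
  have "induced B ?H = induced B (?H - {v}) \<union> ?S" "induced B (?H - {v}) \<inter> ?S = {}"
    by (auto simp: induced_def)
  then have c: "card (induced B ?H) = card (induced B (?H - {v})) + card ?S"
    using card_Un_disjoint[of "induced B (?H - {v})" ?S] finite_induced[OF sparse_finite[OF B]]
    by simp
  have "card ?H = Suc (card (?H - {v}))"
    using card_Suc_Diff1[OF tight_finite[OF t] v(1)] by (rule sym)
  then show ?thesis using c le t by (simp add: tight_def)
qed

text \<open>
  An edge that cannot be added has its ends in some tight set; this is what makes hulls of leftover
  edges tight.
\<close>

lemma tight_if_insert_not_sparse:
  assumes B: "sparse k B" and e: "e \<in> edges G" and n: "\<not> sparse k (insert e B)"
  shows "tight k B (tight_hull k B (ends G e))"
proof -
  obtain X where X: "X \<subseteq> verts G" "X \<noteq> {}"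
    "\<not> card (induced (insert e B) X) + k \<le> k * card X"
    using n e B by (auto simp: sparse_def)
  note s = sparseD[OF B X(1,2)]
  have eX: "ends G e \<subseteq> X"
  proof (rule ccontr)
    assume "\<not> ?thesis"
    then have "induced (insert e B) X = induced B X" by (auto simp: induced_def)
    then show False using s X by simp
  qed
  then have "induced (insert e B) X = insert e (induced B X)" by (auto simp: induced_def)
  then have "card (induced (insert e B) X) \<le> Suc (card (induced B X))"
    using card_insert_le_m1 by (metis card_insert_if finite_induced sparse_finite[OF B] le_Suc_eq lessI order_refl)
  then have "tight k B X" using X s by (simp add: tight_def)
  then show ?thesis using tight_hull_is_tight[OF B _ eX ends_nonempty[OF e]] by simp
qed

lemma card_induced_swap:
  assumes "finite B" "b \<in> B" "e \<notin> B" "ends G e \<subseteq> X" "ends G b \<subseteq> X"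
  shows "card (induced (insert e (B - {b})) X) = card (induced B X)"
proof -
  have "induced (insert e (B - {b})) X = insert e (induced B X - {b})"
    "b \<in> induced B X" "e \<notin> induced B X"
    using assms by (auto simp: induced_def)
  then show ?thesis using card.remove[of "induced B X" b] finite_induced[OF assms(1)] by simp
qed

text \<open>
  The only sets that adding \<open>e\<close> could overfill are the tight sets containing its ends. All
  of them contain the hull, hence also the ends of \<open>b\<close>, and removing \<open>b\<close> makes room in each of them.
\<close>

lemma sparse_swap:
  assumes B: "sparse k B" and e: "e \<in> edges G"
    and b: "b \<in> induced B (tight_hull k B (ends G e))"
  shows "sparse k (insert e (B - {b}))"
  unfolding sparse_def
proof (intro conjI allI impI)
  let ?B = "insert e (B - {b})"
  show "?B \<subseteq> edges G" using e sparse_subset_edges[OF B] by auto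
  fix X assume X: "X \<subseteq> verts G \<and> X \<noteq> {}"
  note fin = finite_induced[OF sparse_finite[OF B]]
  note s = sparseD[OF B, of X]
  show "card (induced ?B X) + k \<le> k * card X"
  proof (cases "ends G e \<subseteq> X")
    case False
    then have "induced ?B X \<subseteq> induced B X" by (auto simp: induced_def)
    then show ?thesis using card_mono[OF fin] s X by (meson add_le_mono1 order_trans)
  next
    case eX: True
    show ?thesis
    proof (cases "ends G b \<subseteq> X")
      case True
      then have "b \<in> induced B X" "induced ?B X = insert e (induced B X - {b})"
        using b eX by (auto simp: induced_def)
      then have "card (induced ?B X) \<le> card (induced B X)"
        using card.remove[OF fin, of b X] card_insert_if[of "induced B X - {b}" e] fin by simp
      then show ?thesis using s X by simp
    next
      case False
      then have "\<not> tight k B X" using tight_hull_least[of k B X "ends G e"] eX b by (auto simp: induced_def)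
      then have "card (induced B X) + k < k * card X" using s X by (simp add: tight_def)
      moreover have "induced ?B X \<subseteq> insert e (induced B X)" by (auto simp: induced_def)
      then have "card (induced ?B X) \<le> card (insert e (induced B X))"
        using fin by (intro card_mono) auto
      then have "card (induced ?B X) \<le> Suc (card (induced B X))"
        using card_insert_if[of "induced B X" e] fin by (simp split: if_splits)
      ultimately show ?thesis by linarith
    qed
  qed
qed

section \<open>Partitioning a sparse edge set into forests\<close>

definition forest_partition :: "nat \<Rightarrow> 'e set \<Rightarrow> (nat \<Rightarrow> 'e set) \<Rightarrow> bool" where
  "forest_partition k B F \<longleftrightarrow> (\<forall>i\<in>{1..k}. sparse 1 (F i)) \<and>
     disjoint_family_on F {1..k} \<and> (\<Union>i\<in>{1..k}. F i) = B"

lemma forest_partition_update: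
  assumes F: "forest_partition k A F" and i: "i \<in> {1..k}" and N: "sparse 1 N"
    and disj: "N \<inter> (A - F i) = {}"
  shows "forest_partition k ((A - F i) \<union> N) (F(i := N))"
proof -
  have d: "F j \<inter> F l = {}" if "j \<in> {1..k}" "l \<in> {1..k}" "j \<noteq> l" for j l
    using F that by (auto simp: forest_partition_def disjoint_family_on_def)
  have A: "F j \<subseteq> A - F i" if "j \<in> {1..k}" "j \<noteq> i" for j
    using d[OF that(1) i that(2)] F that by (auto simp: forest_partition_def)
  have "(\<Union>j\<in>{1..k}. (F(i := N)) j) = N \<union> (\<Union>j\<in>{1..k} - {i}. F j)"
    using i by auto
  also have "(\<Union>j\<in>{1..k} - {i}. F j) = A - F i"
  proof
    show "(\<Union>j\<in>{1..k} - {i}. F j) \<subseteq> A - F i" using A by blast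
    show "A - F i \<subseteq> (\<Union>j\<in>{1..k} - {i}. F j)" using F unfolding forest_partition_def by blast
  qed
  finally have "(\<Union>j\<in>{1..k}. (F(i := N)) j) = (A - F i) \<union> N" by auto
  moreover have "disjoint_family_on (F(i := N)) {1..k}"
    unfolding disjoint_family_on_def
  proof (intro ballI impI)
    fix j l assume jl: "j \<in> {1..k}" "l \<in> {1..k}" "j \<noteq> l"
    show "(F(i := N)) j \<inter> (F(i := N)) l = {}"
      using d[OF jl] A[OF jl(1)] A[OF jl(2)] disj jl(3) by (cases "j = i"; cases "l = i") auto
  qed
  moreover have "\<forall>j\<in>{1..k}. sparse 1 ((F(i := N)) j)"
    using F N by (simp add: forest_partition_def)
  ultimately show ?thesis by (simp add: forest_partition_def)
qed

text \<open>
  A state consists of forests \<open>F\<close> together with the single edge \<open>e\<close> that they miss. One step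
  puts \<open>e\<close> into the \<open>i\<close>-th forest and takes out an edge \<open>f\<close> of the cycle closed by it: the tight hull of
  the ends of \<open>e\<close> in a forest is the vertex set of the path joining them.
\<close>

inductive swaps :: "nat \<Rightarrow> (nat \<Rightarrow> 'e set) \<Rightarrow> 'e \<Rightarrow> (nat \<Rightarrow> 'e set) \<Rightarrow> 'e \<Rightarrow> bool"
  for k F0 e0 where
  start: "swaps k F0 e0 F0 e0"
| swap: "swaps k F0 e0 F e \<Longrightarrow> i \<in> {1..k} \<Longrightarrow> f \<in> induced (F i) (tight_hull 1 (F i) (ends G e)) \<Longrightarrow>
    swaps k F0 e0 (F(i := insert e (F i - {f}))) f"

text \<open>
  The classical exchange argument for Nash-Williams' theorem. If \<open>e0\<close> cannot be accommodated, then
  no state reachable by swaps can accommodate its missing edge. Let \<open>U\<close> be the set of all ends of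
  missing edges of reachable states. Then \<open>U\<close> is tight in each of the \<open>k\<close> initial
  forests, so that these have \<open>k (|U| - 1)\<close> edges inside \<open>U\<close>; together with \<open>e0\<close> this
  is one more than sparsity of \<open>B\<close> permits.
\<close>

lemma forest_partition_insert:
  assumes B: "sparse k B" and e0: "e0 \<in> B" and F0: "forest_partition k (B - {e0}) F0"
  shows "\<exists>F. forest_partition k B F"
proof (rule ccontr)
  assume none: "\<nexists>F. forest_partition k B F"
  let ?R = "swaps k F0 e0"
  let ?T = "\<lambda>F e j. tight_hull 1 (F j) (ends G e)"
  have valid: "e \<in> B \<and> forest_partition k (B - {e}) F" if "?R F e" for F e
    using that
  proof induction
    case start
    then show ?case using e0 F0 by simp
  next
    case (swap F e i f)
    have Fi: "sparse 1 (F i)" "F i \<subseteq> B - {e}" "f \<in> F i"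
      using swap by (auto simp: forest_partition_def induced_def)
    have eB: "e \<in> B" using swap by simp
    then have e: "e \<in> edges G" using B sparse_subset_edges by auto
    have "sparse 1 (insert e (F i - {f}))"
      using sparse_swap[OF Fi(1) e] swap by simp
    then have part: "forest_partition k ((B - {e} - F i) \<union> insert e (F i - {f})) (F(i := insert e (F i - {f})))"
      using swap by (intro forest_partition_update) auto
    have eq: "(B - {e} - F i) \<union> insert e (F i - {f}) = B - {f}"
      using Fi(2,3) eB by blast
    have "f \<in> B" using Fi by blast
    then show ?case using part unfolding eq by (rule conjI)
  qed
  have edge: "e \<in> edges G" if "?R F e" for F e
    using valid[OF that] sparse_subset_edges[OF B] by auto
  have sp: "sparse 1 (F j)" if "?R F e" "j \<in> {1..k}" for F e j
    using valid[OF that(1)] that(2) by (auto simp: forest_partition_def)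
  have tight: "tight 1 (F j) (?T F e j)" if R: "?R F e" and j: "j \<in> {1..k}" for F e j
  proof (rule tight_if_insert_not_sparse[OF sp[OF R j] edge[OF R]])
    have Fj: "F j \<subseteq> B - {e}" using valid[OF R] j by (auto simp: forest_partition_def)
    show "\<not> sparse 1 (insert e (F j))"
    proof
      assume "sparse 1 (insert e (F j))"
      then have "forest_partition k ((B - {e} - F j) \<union> insert e (F j)) (F(j := insert e (F j)))"
        using valid[OF R] j by (intro forest_partition_update) auto
      moreover have "(B - {e} - F j) \<union> insert e (F j) = B" using Fj valid[OF R] by auto
      ultimately show False using none by auto
    qed
  qed
  \<comment> \<open>Every vertex of the hull of a missing edge is an end of an edge that can go missing next.\<close>
  define U where "U = \<Union>{ends G e | F e. ?R F e}"
  have endsU: "ends G e \<subseteq> U" if "?R F e" for F e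
    using that by (auto simp: U_def)
  have TU: "?T F e j \<subseteq> U" if R: "?R F e" and j: "j \<in> {1..k}" for F e j
  proof
    fix v assume v: "v \<in> ?T F e j"
    show "v \<in> U"
    proof (cases "v \<in> ends G e")
      case True
      then show ?thesis using endsU[OF R] by auto
    next
      case False
      have "1 + 1 \<le> card {b \<in> induced (F j) (?T F e j). v \<in> ends G b}"
        using degree_in_hull[OF sp[OF R j] tight[OF R j] ends_nonempty[OF edge[OF R]] v False] .
      then have "{b \<in> induced (F j) (?T F e j). v \<in> ends G b} \<noteq> {}" by (metis card.empty not_numeral_le_zero one_add_one)
      then obtain f where f: "f \<in> induced (F j) (?T F e j)" "v \<in> ends G f" by auto
      then show ?thesis using endsU[OF swaps.swap[OF R j f(1)]] by auto
    qed
  qed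
  have Utight: "tight 1 (F0 j) U" if j: "j \<in> {1..k}" for j
  proof -
    \<comment> \<open>\<open>A\<close> is the component of \<open>e0\<close> in the part of the \<open>j\<close>-th forest inside \<open>U\<close>. Each swap keeps \<open>A\<close> a
      component of the \<open>j\<close>-th forest inside \<open>U\<close> and the missing edge inside \<open>A\<close>, whence \<open>U = A\<close>.\<close>
    define A where "A = \<Union>{T. tight 1 (F0 j) T \<and> T \<subseteq> U \<and> T \<inter> ?T F0 e0 j \<noteq> {}}"
    define maxt where "maxt H \<longleftrightarrow> tight 1 H A \<and> A \<subseteq> U \<and>
      (\<forall>T. tight 1 H T \<and> T \<subseteq> U \<and> T \<inter> A \<noteq> {} \<longrightarrow> T \<subseteq> A)" for H
    have R0: "?R F0 e0" by (rule swaps.start)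
    have T0: "?T F0 e0 j \<noteq> {}" using tight[OF R0 j] by (simp add: tight_def)
    have T0A: "?T F0 e0 j \<subseteq> A" using tight[OF R0 j] TU[OF R0 j] T0 by (auto simp: A_def)
    have inv: "maxt (F j) \<and> ends G e \<subseteq> A" if "?R F e" for F e
      using that
    proof induction
      case start
      let ?\<T> = "{T. tight 1 (F0 j) T \<and> T \<subseteq> U \<and> T \<inter> ?T F0 e0 j \<noteq> {}}"
      have "finite ?\<T>"
        by (rule finite_subset[of _ "Pow (verts G)"]) (auto simp: tight_def finite_verts)
      then have "tight 1 (F0 j) (?T F0 e0 j \<union> \<Union>?\<T>)"
        using tight_Un_Union[OF sp[OF R0 j] tight[OF R0 j], of ?\<T>] by simp
      moreover have "?T F0 e0 j \<union> \<Union>?\<T> = A" using T0A by (auto simp: A_def)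
      ultimately have At: "tight 1 (F0 j) A" by simp
      have "T \<subseteq> A" if T: "tight 1 (F0 j) T" "T \<subseteq> U" "T \<inter> A \<noteq> {}" for T
      proof -
        have "tight 1 (F0 j) (A \<union> T)"
          using tight_Un_Int(1)[OF sp[OF R0 j] At T(1)] T by auto
        moreover have "A \<union> T \<subseteq> U" using T by (auto simp: A_def)
        moreover have "(A \<union> T) \<inter> ?T F0 e0 j \<noteq> {}" using T0 T0A by auto
        ultimately have "A \<union> T \<subseteq> A" by (subst (2) A_def) (intro Union_upper, blast)
        then show ?thesis by simp
      qed
      moreover have "A \<subseteq> U" by (auto simp: A_def)
      ultimately have "maxt (F0 j)" using At by (simp add: maxt_def)
      moreover have "ends G e0 \<subseteq> A" using subset_tight_hull T0A by (rule order_trans)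
      ultimately show ?case by (rule conjI)
    next
      case (swap F e i f)
      have R': "?R (F(i := insert e (F i - {f}))) f" using swaps.swap swap by blast
      have m: "maxt (F j)" and eA: "ends G e \<subseteq> A" using swap by auto
      have At: "tight 1 (F j) A" and AU: "A \<subseteq> U" using m by (auto simp: maxt_def)
      have enr: "e \<notin> F j" using valid[OF swap(1)] j by (auto simp: forest_partition_def)
      show ?case
      proof (cases "i = j")
        case True
        have "?T F e j \<inter> A \<noteq> {}"
          using subset_tight_hull[of "ends G e"] eA ends_nonempty[OF edge[OF swap(1)]] by blast
        then have TA: "?T F e j \<subseteq> A"
          using m tight[OF swap(1) j] TU[OF swap(1) j] by (auto simp: maxt_def)
        then have fA: "ends G f \<subseteq> A" "f \<in> F j" using swap.hyps True unfolding induced_def by blast+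
        let ?H = "insert e (F j - {f})"
        note fin = sparse_finite[OF sp[OF swap(1) j]]
        have same: "card (induced ?H X) = card (induced (F j) X)" if "A \<subseteq> X" for X
          using card_induced_swap[OF fin fA(2) enr order_trans[OF eA that] order_trans[OF fA(1) that]] .
        have tt: "tight 1 ?H X \<longleftrightarrow> tight 1 (F j) X" if "A \<subseteq> X" for X
          using same[OF that] by (simp add: tight_def)
        have Hs: "sparse 1 ?H" using sp[OF R' j] True by simp
        have "T \<subseteq> A" if T: "tight 1 ?H T" "T \<subseteq> U" "T \<inter> A \<noteq> {}" for T
        proof -
          have "tight 1 ?H (A \<union> T)"
            using tight_Un_Int(1)[OF Hs _ T(1)] tt[OF order_refl] At T(3) by (simp add: Int_commute)
          then have "tight 1 (F j) (A \<union> T)" using tt[of "A \<union> T"] by simp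
          moreover have "A \<union> T \<subseteq> U" "(A \<union> T) \<inter> A \<noteq> {}" using T AU by blast+
          ultimately have "A \<union> T \<subseteq> A" using m unfolding maxt_def by blast
          then show ?thesis by simp
        qed
        then have "maxt ?H" using tt[OF order_refl] At AU unfolding maxt_def by blast
        then show ?thesis using fA True by simp
      next
        case False
        \<comment> \<open>The path closed by \<open>e\<close> in another forest stays in \<open>A\<close>. Each edge \<open>g\<close> on it can go missing, and
          the \<open>j\<close>-th forest then joins the ends of \<open>g\<close> inside \<open>U\<close>, so \<open>g\<close> does not leave the component
          \<open>A\<close>. A path starting in \<open>A\<close> without an edge leaving \<open>A\<close> stays in \<open>A\<close>; this is counted below.\<close>
        have split: "ends G g \<subseteq> A \<or> ends G g \<inter> A = {}" if g: "g \<in> induced (F i) (?T F e i)" for g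
        proof -
          let ?F = "F(i := insert e (F i - {g}))"
          have Rg: "?R ?F g" by (rule swaps.swap[OF swap(1,2) g])
          have "?F j = F j" using False by simp
          then have "tight 1 (F j) (tight_hull 1 (F j) (ends G g))" "tight_hull 1 (F j) (ends G g) \<subseteq> U"
            using tight[OF Rg j] TU[OF Rg j] by auto
          then show ?thesis using m subset_tight_hull[of "ends G g" 1 "F j"] unfolding maxt_def by blast
        qed
        let ?X = "?T F e i"
        have Fi: "sparse 1 (F i)" and tX: "tight 1 (F i) ?X" using sp[OF swap(1,2)] tight[OF swap(1,2)] .
        have fin: "finite (induced (F i) X)" for X using finite_induced[OF sparse_finite[OF Fi]] .
        have "?X \<inter> A \<noteq> {}"
          using subset_tight_hull[of "ends G e"] eA ends_nonempty[OF edge[OF swap(1)]] by blast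
        then have c1: "card (induced (F i) (?X \<inter> A)) + 1 \<le> card (?X \<inter> A)"
          using sparseD[OF Fi, of "?X \<inter> A"] tX by (auto simp: tight_def)
        have "induced (F i) ?X \<subseteq> induced (F i) (?X \<inter> A) \<union> induced (F i) (?X - A)"
          using split unfolding induced_def by blast
        then have c2: "card (induced (F i) ?X) \<le> card (induced (F i) (?X \<inter> A)) + card (induced (F i) (?X - A))"
          by (meson card_Un_le card_mono fin finite_UnI order_trans)
        have c3: "card ?X = card (?X \<inter> A) + card (?X - A)"
          using tight_finite[OF tX] by (metis card_Int_Diff)
        have "?X - A = {}"
        proof (rule ccontr)
          assume "?X - A \<noteq> {}"
          then have "card (induced (F i) (?X - A)) + 1 \<le> card (?X - A)"
            using sparseD[OF Fi, of "?X - A"] tX by (auto simp: tight_def)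
          then show False using c1 c2 c3 tX by (simp add: tight_def)
        qed
        then have "ends G f \<subseteq> A" using swap.hyps unfolding induced_def by blast
        then show ?thesis using m False by simp
      qed
    qed
    have "U \<subseteq> A" using inv by (auto simp: U_def)
    then have "U = A" using inv[OF R0] by (auto simp: maxt_def)
    then show ?thesis using inv[OF R0] by (simp add: maxt_def)
  qed
  have R0: "?R F0 e0" by (rule swaps.start)
  have UV: "U \<subseteq> verts G" using edge ends_subset by (auto simp: U_def)
  have Une: "U \<noteq> {}" using endsU[OF R0] ends_nonempty[OF edge[OF R0]] by auto
  have finB: "finite B" using sparse_finite[OF B] .
  have F0B: "F0 j \<subseteq> B - {e0}" if "j \<in> {1..k}" for j
    using F0 that by (auto simp: forest_partition_def)
  have "(\<Sum>j\<in>{1..k}. card (induced (F0 j) U)) = card (\<Union>j\<in>{1..k}. induced (F0 j) U)"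
  proof (rule card_UN_disjoint[symmetric])
    show "\<forall>i\<in>{1..k}. finite (induced (F0 i) U)"
      using F0B finB by (meson Diff_subset finite_induced finite_subset)
    show "\<forall>i\<in>{1..k}. \<forall>j\<in>{1..k}. i \<noteq> j \<longrightarrow> induced (F0 i) U \<inter> induced (F0 j) U = {}"
      using F0 unfolding forest_partition_def disjoint_family_on_def induced_def by blast
  qed simp
  also have "\<dots> < card (induced B U)"
  proof (rule psubset_card_mono)
    have "e0 \<in> induced B U"
      using e0 endsU[OF R0] by (simp add: induced_def)
    moreover have "(\<Union>j\<in>{1..k}. induced (F0 j) U) \<subseteq> induced (B - {e0}) U"
      using F0B by (intro UN_least induced_mono) auto
    then have "(\<Union>j\<in>{1..k}. induced (F0 j) U) \<subseteq> induced B U"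
      "e0 \<notin> (\<Union>j\<in>{1..k}. induced (F0 j) U)"
      unfolding induced_def by blast+
    ultimately show "(\<Union>j\<in>{1..k}. induced (F0 j) U) \<subset> induced B U" by blast
  qed (rule finite_induced[OF finB])
  finally have "(\<Sum>j\<in>{1..k}. card (induced (F0 j) U)) + k < k * card U"
    using sparseD[OF B UV Une] by linarith
  moreover have "k * card U = (\<Sum>j\<in>{1..k}. card (induced (F0 j) U) + 1)"
    using Utight by (simp add: tight_def)
  moreover have "\<dots> = (\<Sum>j\<in>{1..k}. card (induced (F0 j) U)) + k"
    by (subst sum.distrib) simp
  ultimately show False by linarith
qed

text \<open>Nash-Williams' theorem on the decomposition into \<open>k\<close> forests.\<close>

theorem sparse_imp_forest_partition:
  assumes "sparse k B"
  shows "\<exists>F. forest_partition k B F"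
  using sparse_finite[OF assms] assms
proof (induction B rule: finite_induct)
  case empty
  have "forest_partition k {} (\<lambda>_. {})"
    unfolding forest_partition_def disjoint_family_on_def using sparse_empty[of 1] by auto
  then show ?case by blast
next
  case (insert e B)
  have "sparse k B" by (rule sparse_mono[OF insert.prems]) auto
  then obtain F where F: "forest_partition k B F" using insert.IH by metis
  have "insert e B - {e} = B" using insert.hyps by simp
  then have "forest_partition k (insert e B - {e}) F" using F by (simp only:)
  with insert.prems insertI1 show ?case by (rule forest_partition_insert)
qed

lemma sparse_1_imp_forest_edge_set:
  assumes "sparse 1 F"
  shows "forest_edge_set G F"
proof -
  let ?H = "\<lparr>verts = verts G, edges = F, ends = ends G\<rparr>"
  have FE: "F \<subseteq> edges G" using sparse_subset_edges[OF assms] .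
  have H: "finite_multigraph ?H"
    using finite_verts sparse_finite[OF assms] ends_subset card_ends FE
    by unfold_locales auto
  have "\<not> is_cycle ?H vs es" for vs es
  proof
    assume c: "is_cycle ?H vs es"
    have inside: "ends G (es ! i) \<subseteq> set vs" if "i < length vs" for i
      using c that by (auto simp: is_cycle_def intro!: nth_mem mod_less_divisor)
    have "set es \<subseteq> induced F (set vs)"
    proof (intro subsetI)
      fix e assume e: "e \<in> set es"
      then obtain i where "i < length vs" "e = es ! i"
        using c by (auto simp: is_cycle_def in_set_conv_nth)
      then have "ends G e \<subseteq> set vs" using inside by simp
      then show "e \<in> induced F (set vs)" using e c by (auto simp: is_cycle_def induced_def)
    qed
    then have "card (set es) \<le> card (induced F (set vs))"
      by (intro card_mono finite_induced sparse_finite[OF assms])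
    moreover have "card (set es) = card (set vs)"
      using c by (simp add: is_cycle_def distinct_card)
    moreover have "card (induced F (set vs)) + 1 \<le> 1 * card (set vs)"
      using c by (intro sparseD[OF assms]) (auto simp: is_cycle_def)
    ultimately show False by simp
  qed
  then show ?thesis
    using H FE unfolding forest_edge_set_def forest_def subgraph_def
    by (intro exI[of _ ?H]) simp
qed

section \<open>Leftover edges and the layers around a crowded vertex\<close>

definition degree :: "'e set \<Rightarrow> 'v \<Rightarrow> nat" where
  "degree F v = card {e \<in> F. v \<in> ends G e}"

definition incident :: "'e set \<Rightarrow> 'v set \<Rightarrow> 'e set" where
  "incident F W = {e \<in> F. ends G e \<inter> W \<noteq> {}}"

text \<open>
  With truncated subtraction a vertex met by at most one edge contributes nothing, so the excess vanishes
  exactly if no two edges of \<open>F\<close> share a vertex.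
\<close>

definition excess :: "'e set \<Rightarrow> nat" where
  "excess F = (\<Sum>v\<in>verts G. degree F v - 1)"

definition saturated :: "nat \<Rightarrow> 'e set \<Rightarrow> bool" where
  "saturated k B \<longleftrightarrow> sparse k B \<and> (\<forall>e\<in>edges G - B. \<not> sparse k (insert e B))"

definition expand :: "nat \<Rightarrow> 'e set \<Rightarrow> 'v set \<Rightarrow> 'v set" where
  "expand k B Z = tight_hull k B (Z \<union> \<Union>(ends G ` incident (edges G - B) Z))"

primrec layer :: "nat \<Rightarrow> 'e set \<Rightarrow> 'v \<Rightarrow> nat \<Rightarrow> 'v set" where
  "layer k B r 0 = {r}"
| "layer k B r (Suc j) = expand k B (layer k B r j)"

lemma saturated_sparse: "saturated k B \<Longrightarrow> sparse k B"
  by (simp add: saturated_def)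

lemma saturated_tight_hull:
  "saturated k B \<Longrightarrow> e \<in> edges G - B \<Longrightarrow> tight k B (tight_hull k B (ends G e))"
  by (rule tight_if_insert_not_sparse) (auto simp: saturated_def)

text \<open>
  The set \<open>Z\<close> together with the hulls of the leftover edges touching it is a union of tight sets
  meeting \<open>Z\<close>, hence tight, and by \<open>tight_Un_Union\<close> each of its \<open>B\<close>-edges lies in \<open>Z\<close> or in one of these hulls.
  A new \<open>B\<close>-edge can therefore be swapped with a leftover edge that touches \<open>Z\<close>.
\<close>

lemma
  assumes B: "saturated k B" and Z: "tight k B Z"
  shows tight_expand: "tight k B (expand k B Z)"
    and expand_swappable: "b \<in> induced B (expand k B Z) \<Longrightarrow> b \<notin> induced B Z \<Longrightarrow>
      \<exists>e\<in>incident (edges G - B) Z. b \<in> induced B (tight_hull k B (ends G e))"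
proof -
  let ?I = "incident (edges G - B) Z"
  let ?T = "(\<lambda>e. tight_hull k B (ends G e)) ` ?I"
  let ?W = "Z \<union> \<Union>(ends G ` ?I)"
  have fin: "finite ?T"
    by (intro finite_imageI finite_subset[OF _ finite_edges]) (auto simp: incident_def)
  have T: "tight k B T \<and> T \<inter> Z \<noteq> {}" if "T \<in> ?T" for T
  proof -
    from that obtain e where e: "e \<in> ?I" "T = tight_hull k B (ends G e)" by (rule imageE) simp
    then have "ends G e \<inter> Z \<noteq> {}" "e \<in> edges G - B" by (auto simp: incident_def)
    moreover have "ends G e \<subseteq> T" unfolding e(2) by (rule subset_tight_hull)
    ultimately show ?thesis using saturated_tight_hull[OF B] e(2) by blast
  qed
  note U = tight_Un_Union[OF saturated_sparse[OF B] Z fin T]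
  have "\<Union>(ends G ` ?I) \<subseteq> \<Union>?T"
    using subset_tight_hull by (intro UN_mono) auto
  then have WU: "?W \<subseteq> Z \<union> \<Union>?T" by blast
  have "Z \<noteq> {}" using Z by (simp add: tight_def)
  then have ne: "?W \<noteq> {}" by simp
  show "tight k B (expand k B Z)"
    unfolding expand_def
    using U by (intro tight_hull_is_tight[OF saturated_sparse[OF B] _ WU ne]) simp
  assume b: "b \<in> induced B (expand k B Z)" "b \<notin> induced B Z"
  have "expand k B Z \<subseteq> Z \<union> \<Union>?T"
    unfolding expand_def using U WU by (intro tight_hull_least) simp_all
  then have "b \<in> induced B (Z \<union> \<Union>?T)"
    using b(1) induced_mono[OF order_refl] by blast
  then have "b \<in> induced B Z \<union> (\<Union>T\<in>?T. induced B T)"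
    using U by simp
  then show "\<exists>e\<in>?I. b \<in> induced B (tight_hull k B (ends G e))"
    using b(2) by simp
qed

lemma subset_expand: "Z \<subseteq> expand k B Z"
  unfolding expand_def using subset_tight_hull by blast

lemma incident_subset_expand:
  "e \<in> incident (edges G - B) Z \<Longrightarrow> ends G e \<subseteq> expand k B Z"
  unfolding expand_def
  by (rule order_trans[OF _ subset_tight_hull]) blast

lemma tight_layer:
  assumes "saturated k B" "r \<in> verts G"
  shows "tight k B (layer k B r j)"
  by (induction j) (simp_all add: assms tight_singleton saturated_sparse tight_expand)

lemma layer_mono: "i \<le> j \<Longrightarrow> layer k B r i \<subseteq> layer k B r j"
  by (rule lift_Suc_mono_le[of "layer k B r"]) (simp_all add: subset_expand)

text \<open>
  A swap at layer \<open>j\<close> is invisible to the earlier layers. The new member \<open>e\<close> of \<open>B\<close> is not inside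
  \<open>Z\<^sub>j\<close>, as otherwise its hull, and with it \<open>b\<close>, would be; so it touches no \<open>Z\<^sub>i\<close> with \<open>i < j\<close>. The new
  leftover edge \<open>b\<close> avoids \<open>Z\<^sub>j\<close> altogether. Hence the same subsets of \<open>Z\<^sub>j\<close> are tight before and after.
\<close>

lemma
  assumes B: "saturated k B" and r: "r \<in> verts G"
    and e: "e \<in> incident (edges G - B) (layer k B r j)"
    and b: "b \<in> induced B (tight_hull k B (ends G e))"
    and disj: "ends G b \<inter> layer k B r j = {}"
  shows layer_swap: "i \<le> j \<Longrightarrow> layer k (insert e (B - {b})) r i = layer k B r i"
    and incident_layer_swap: "i < j \<Longrightarrow>
      incident (edges G - insert e (B - {b})) (layer k B r i) = incident (edges G - B) (layer k B r i)"
    and incident_last_layer_swap: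
      "incident (edges G - insert e (B - {b})) (layer k B r j) = incident (edges G - B) (layer k B r j) - {e}"
proof -
  let ?B = "insert e (B - {b})"
  let ?Z = "layer k B r"
  have eE: "e \<in> edges G" "e \<notin> B" using e by (auto simp: incident_def)
  have bB: "b \<in> B" using b by (simp add: induced_def)
  have bE: "b \<in> edges G" using bB sparse_subset_edges[OF saturated_sparse[OF B]] by blast
  have sp: "sparse k ?B"
    by (rule sparse_swap[OF saturated_sparse[OF B] eE(1) b])
  have e_out: "\<not> ends G e \<subseteq> ?Z i" if "i \<le> j" for i
  proof
    assume "ends G e \<subseteq> ?Z i"
    then have "tight_hull k B (ends G e) \<subseteq> ?Z i"
      by (rule tight_hull_least[OF tight_layer[OF B r]])
    then have "ends G b \<subseteq> ?Z j" using b layer_mono[OF that, of k B r] by (auto simp: induced_def)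
    then show False using disj ends_nonempty[OF bE] by blast
  qed
  have e_inc: "e \<notin> incident (edges G - B) (?Z i)" if "i < j" for i
    using e_out[of "Suc i"] incident_subset_expand[of e B "?Z i" k] that by auto
  have compl: "edges G - ?B = insert b (edges G - B - {e})"
    using eE bE bB by blast
  have inc: "incident (edges G - ?B) W = incident (edges G - B) W - {e}" if "W \<subseteq> ?Z j" for W
    unfolding compl incident_def using that disj by blast
  show last: "incident (edges G - ?B) (?Z j) = incident (edges G - B) (?Z j) - {e}"
    by (rule inc) simp
  have earlier: "incident (edges G - ?B) (?Z i) = incident (edges G - B) (?Z i)" if "i < j" for i
    using inc[of "?Z i"] e_inc[OF that] layer_mono[of i j k B r] that by simp
  then show "i < j \<Longrightarrow> incident (edges G - ?B) (?Z i) = incident (edges G - B) (?Z i)" .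
  have tt: "tight k ?B X \<longleftrightarrow> tight k B X" if "X \<subseteq> ?Z j" for X
  proof -
    have "\<not> ends G e \<subseteq> X" using e_out[of j] that by blast
    moreover have "\<not> ends G b \<subseteq> X" using disj ends_nonempty[OF bE] that by blast
    ultimately have "induced ?B X = induced B X" unfolding induced_def by blast
    then show ?thesis by (simp add: tight_def)
  qed
  show "layer k ?B r i = ?Z i" if "i \<le> j"
    using that
  proof (induction i)
    case 0
    show ?case by simp
  next
    case (Suc i)
    then have IH: "layer k ?B r i = ?Z i" and ij: "i < j" by auto
    let ?S = "?Z i \<union> \<Union>(ends G ` incident (edges G - B) (?Z i))"
    have S: "?Z (Suc i) = tight_hull k B ?S" by (simp add: expand_def)
    have S': "layer k ?B r (Suc i) = tight_hull k ?B ?S"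
      by (simp only: layer.simps expand_def IH earlier[OF ij])
    have ne: "?S \<noteq> {}" using tight_layer[OF B r, of i] by (simp add: tight_def)
    have sub: "?Z (Suc i) \<subseteq> ?Z j" using ij by (intro layer_mono) simp
    have tZ: "tight k ?B (?Z (Suc i))"
      using tt[OF sub] tight_layer[OF B r] by blast
    have SZ: "?S \<subseteq> ?Z (Suc i)" unfolding S by (rule subset_tight_hull)
    have le: "tight_hull k ?B ?S \<subseteq> ?Z (Suc i)"
      by (rule tight_hull_least[OF tZ SZ])
    have "tight k ?B (tight_hull k ?B ?S)"
      by (rule tight_hull_is_tight[OF sp tZ SZ ne])
    then have "tight k B (tight_hull k ?B ?S)"
      using tt[OF order_trans[OF le sub]] by blast
    then have "?Z (Suc i) \<subseteq> tight_hull k ?B ?S"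
      unfolding S by (rule tight_hull_least) (rule subset_tight_hull)
    then show ?case unfolding S' using le by (rule equalityI[rotated])
  qed
qed

text \<open>
  Passing from the tight set \<open>Z\<close> to the tight set \<open>H\<close> adds exactly \<open>k\<close> edges for each new vertex, while each
  vertex of \<open>H\<close> outside \<open>W\<close> has at least \<open>k + 1\<close> edges in \<open>H\<close>. If the new vertices in \<open>I\<close> lie outside \<open>W\<close> and
  are pairwise non-adjacent, their edges are all new and distinct, so the surplus of one edge for each of them has
  to be met from the \<open>k\<close> edges that each of the other new vertices brings.
\<close>

lemma card_independent_in_hull:
  assumes B: "sparse k B" and Z: "tight k B Z" and H: "tight k B H"
    and HW: "H = tight_hull k B W" and ZW: "Z \<subseteq> W" and IW: "I \<inter> W \<subseteq> Z"
    and indep: "\<And>b u v. b \<in> induced B H \<Longrightarrow> u \<in> ends G b \<Longrightarrow> v \<in> ends G b \<Longrightarrow>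
      u \<in> (H - Z) \<inter> I \<Longrightarrow> v \<in> (H - Z) \<inter> I \<Longrightarrow> u = v"
  shows "card ((H - Z) \<inter> I) \<le> k * card (H - Z - I)"
proof -
  let ?D = "(H - Z) \<inter> I"
  let ?S = "\<lambda>v. {b \<in> induced B H. v \<in> ends G b}"
  let ?N = "induced B H - induced B Z"
  have fin: "finite (induced B X)" for X by (rule finite_induced[OF sparse_finite[OF B]])
  have finH: "finite H" by (rule tight_finite[OF H])
  have ZH: "Z \<subseteq> H" using ZW subset_tight_hull unfolding HW by (rule order_trans)
  have "W \<noteq> {}" using Z ZW by (auto simp: tight_def)
  then have deg: "k + 1 \<le> card (?S v)" if "v \<in> ?D" for v
    using degree_in_hull[OF B, of W v] H IW that unfolding HW by blast
  have "(k + 1) * card ?D = (\<Sum>v\<in>?D. k + 1)" by simp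
  also have "\<dots> \<le> (\<Sum>v\<in>?D. card (?S v))" by (rule sum_mono) (rule deg)
  also have "\<dots> = card (\<Union>v\<in>?D. ?S v)"
  proof (rule card_UN_disjoint[symmetric])
    show "finite ?D" using finH by simp
    show "\<forall>v\<in>?D. finite (?S v)" using fin by simp
    show "\<forall>u\<in>?D. \<forall>v\<in>?D. u \<noteq> v \<longrightarrow> ?S u \<inter> ?S v = {}" using indep by blast
  qed
  also have "\<dots> \<le> card ?N"
  proof (rule card_mono)
    show "finite ?N" using fin by simp
    show "(\<Union>v\<in>?D. ?S v) \<subseteq> ?N" unfolding induced_def by blast
  qed
  finally have 1: "(k + 1) * card ?D \<le> card ?N" .
  have "induced B Z \<subseteq> induced B H" by (rule induced_mono[OF order_refl ZH])
  then have 2: "card (induced B H) = card (induced B Z) + card ?N"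
    using card_Diff_subset[OF fin, of Z "induced B H"] card_mono[OF fin, of "induced B Z" H] by simp
  have 3: "card H = card Z + card (H - Z)"
    using card_Diff_subset[OF finite_subset[OF ZH finH] ZH] card_mono[OF finH ZH] by simp
  have 4: "card (H - Z) = card ?D + card (H - Z - I)"
    using finH card_Int_Diff[of "H - Z" I] by simp
  have "card ?N = k * card (H - Z)"
    using 2 3 Z H by (simp add: tight_def distrib_left)
  then show ?thesis using 1 4 by (simp add: distrib_left)
qed

section \<open>Choosing the leftover edges to be a matching\<close>

text \<open>
  The hypothesis is \<open>|E[X]| \<le> (k + 1 / (3 k + 2)) (|X| - 1)\<close> multiplied by \<open>3 k + 2\<close> and freed of subtraction.
\<close>

lemma sparse_with_matching_complement:
  assumes dens: "\<And>X. X \<subseteq> verts G \<Longrightarrow> X \<noteq> {} \<Longrightarrow>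
    (3 * k + 2) * card (induced (edges G) X) + (k * (3 * k + 2) + 1) \<le> (k * (3 * k + 2) + 1) * card X"
  shows "\<exists>B. sparse k B \<and> (\<forall>v. degree (edges G - B) v \<le> 1)"
proof (rule ccontr)
  assume none: "\<not> ?thesis"
  define \<B> where "\<B> = {B. sparse k B \<and> (\<forall>A. sparse k A \<longrightarrow> card A \<le> card B)}"
  have sat: "saturated k B" if "B \<in> \<B>" for B
    unfolding saturated_def
  proof (intro conjI ballI notI)
    show "sparse k B" using that by (simp add: \<B>_def)
    fix e assume e: "e \<in> edges G - B" "sparse k (insert e B)"
    then have "card (insert e B) \<le> card B" using that by (simp add: \<B>_def)
    then show False using e sparse_finite[of k B] that by (simp add: \<B>_def)
  qed
  have "card A \<le> card (edges G)" if "sparse k A" for A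
    using that by (intro card_mono finite_edges sparse_subset_edges)
  then obtain B1 where "sparse k B1" "\<And>A. sparse k A \<Longrightarrow> card A \<le> card B1"
    using ex_has_greatest_nat[of "sparse k" "{}" card "Suc (card (edges G))"] sparse_empty[of k]
    by (auto simp: less_Suc_eq_le)
  then have "B1 \<in> \<B>" by (simp add: \<B>_def)
  then obtain B0 where B0: "B0 \<in> \<B>"
    "\<And>B. B \<in> \<B> \<Longrightarrow> excess (edges G - B0) \<le> excess (edges G - B)"
    using ex_has_least_nat[of "\<lambda>B. B \<in> \<B>" B1 "\<lambda>B. excess (edges G - B)"] by blast
  obtain r where r2: "2 \<le> degree (edges G - B0) r"
    using none saturated_sparse[OF sat[OF B0(1)]] by (metis Suc_1 not_less_eq_eq)
  then have "{e \<in> edges G - B0. r \<in> ends G e} \<noteq> {}"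
    unfolding degree_def by (metis card.empty not_numeral_le_zero)
  then have rV: "r \<in> verts G" using ends_subset by blast
  define \<C> where "\<C> = {B \<in> \<B>. excess (edges G - B) = excess (edges G - B0) \<and> 2 \<le> degree (edges G - B) r}"
  define t where "t B j = card (incident (edges G - B) (layer k B r j))" for B j
  have "\<C> \<noteq> {}" using B0 r2 by (auto simp: \<C>_def)
  then obtain B where BC: "B \<in> \<C>" and lex: "\<And>A j. A \<in> \<C> \<Longrightarrow> j < card (verts G) \<Longrightarrow>
      (\<forall>i<j. t A i = t B i) \<Longrightarrow> t B j \<le> t A j"
    using lexicographic_minimum[of \<C> "card (verts G)" t] by blast
  have BB: "B \<in> \<B>" using BC by (simp add: \<C>_def)
  have satB: "saturated k B" using sat[OF BB] .
  have spB: "sparse k B" using saturated_sparse[OF satB] .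
  \<comment> \<open>\<open>I\<close> is the set of free vertices, those that no leftover edge covers.\<close>
  define F where "F = edges G - B"
  define Z where "Z = layer k B r"
  define I where "I = - \<Union>(ends G ` F)"
  have finF: "finite F" using finite_edges by (simp add: F_def)
  have Zt: "tight k B (Z j)" for j unfolding Z_def by (rule tight_layer[OF satB rV])
  have ZV: "Z j \<subseteq> verts G" for j using Zt by (simp add: tight_def)
  have Zs: "Z (Suc j) = tight_hull k B (Z j \<union> \<Union>(ends G ` incident F (Z j)))" for j
    by (simp add: Z_def F_def expand_def)
  have rF: "2 \<le> degree F r" using BC by (simp add: \<C>_def F_def)
  then have "{e \<in> F. r \<in> ends G e} \<noteq> {}"
    unfolding degree_def by (metis card.empty not_numeral_le_zero)
  then have rI: "r \<notin> I" unfolding I_def by blast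
  \<comment> \<open>An edge of \<open>B\<close> joining two free vertices of a new layer could be swapped, against the choice of \<open>B\<close>.\<close>
  have indep: "u = v" if j: "j < card (verts G)" and b: "b \<in> induced B (Z (Suc j))"
    and u: "u \<in> ends G b" "u \<in> (Z (Suc j) - Z j) \<inter> I"
    and v: "v \<in> ends G b" "v \<in> (Z (Suc j) - Z j) \<inter> I" for j b u v
  proof (rule ccontr)
    assume uv: "u \<noteq> v"
    have bB: "b \<in> B" using b by (simp add: induced_def)
    have bE: "b \<in> edges G" using bB sparse_subset_edges[OF spB] by blast
    have "card {u, v} = 2" using uv by simp
    then have "card (ends G b) \<le> card {u, v}" using card_ends[OF bE] by auto
    then have ends_b: "ends G b = {u, v}"
      using card_seteq[OF finite_ends[OF bE], of "{u, v}"] u v by simp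
    have bI: "ends G b \<subseteq> I" using ends_b u v by simp
    have disj: "ends G b \<inter> Z j = {}" using ends_b u v by simp
    then have "b \<notin> induced B (Z j)" using ends_b by (auto simp: induced_def)
    then obtain e where e: "e \<in> incident F (Z j)" "b \<in> induced B (tight_hull k B (ends G e))"
      using expand_swappable[OF satB Zt[of j], of b] b by (auto simp: Z_def F_def)
    note swap = layer_swap[OF satB rV e[unfolded F_def Z_def] disj[unfolded Z_def]]
      incident_layer_swap[OF satB rV e[unfolded F_def Z_def] disj[unfolded Z_def]]
      incident_last_layer_swap[OF satB rV e[unfolded F_def Z_def] disj[unfolded Z_def]]
    let ?B = "insert e (B - {b})"
    have eF: "e \<in> F" using e by (simp add: incident_def)
    then have eE: "e \<in> edges G" "e \<notin> B" by (auto simp: F_def)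
    have eI: "ends G e \<inter> I = {}" using eF by (auto simp: I_def)
    have "card ?B = card B"
      using eE bB sparse_finite[OF spB] card_Suc_Diff1[of B b] by simp
    moreover have "sparse k ?B" by (rule sparse_swap[OF spB eE(1) e(2)])
    ultimately have BB': "?B \<in> \<B>" using BB by (simp add: \<B>_def)
    have F': "edges G - ?B = insert b (F - {e})" using eE bE bB unfolding F_def by blast
    have deg: "degree (edges G - ?B) w - 1 \<le> degree F w - 1" for w
    proof (cases "w \<in> ends G b")
      case True
      then have "w \<in> I" using bI by blast
      then have "{f \<in> insert b (F - {e}). w \<in> ends G f} \<subseteq> {b}" unfolding I_def by blast
      then have "degree (edges G - ?B) w \<le> card {b}"
        unfolding F' degree_def by (intro card_mono) auto
      then show ?thesis by simp
    next
      case False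
      then have "{f \<in> insert b (F - {e}). w \<in> ends G f} \<subseteq> {f \<in> F. w \<in> ends G f}" by blast
      then have "degree (edges G - ?B) w \<le> degree F w"
        unfolding F' degree_def using finF by (intro card_mono) auto
      then show ?thesis by simp
    qed
    have rb: "r \<notin> ends G b" using rI bI by blast
    have exc: "excess F \<le> excess (edges G - ?B)"
      using B0(2)[OF BB'] BC by (simp add: \<C>_def F_def)
    \<comment> \<open>Dropping a leftover edge at the crowded vertex \<open>r\<close> would lower the excess, so \<open>r\<close> stays crowded.\<close>
    have re: "r \<notin> ends G e"
    proof
      assume re: "r \<in> ends G e"
      have "{f \<in> insert b (F - {e}). r \<in> ends G f} = {f \<in> F. r \<in> ends G f} - {e}"
        using rb by blast
      then have "degree (edges G - ?B) r < degree F r"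
        unfolding F' degree_def using card_Diff1_less[of "{f \<in> F. r \<in> ends G f}" e] finF eF re by simp
      then have "degree (edges G - ?B) r - 1 < degree F r - 1" using rF by simp
      then have "excess (edges G - ?B) < excess F"
        unfolding excess_def using deg rV
        by (intro sum_strict_mono_ex1[OF finite_verts]) auto
      then show False using exc by simp
    qed
    have "excess (edges G - ?B) \<le> excess F"
      unfolding excess_def by (rule sum_mono) (rule deg)
    then have "excess (edges G - ?B) = excess (edges G - B0)"
      using exc BC by (simp add: \<C>_def F_def)
    moreover have "{f \<in> insert b (F - {e}). r \<in> ends G f} = {f \<in> F. r \<in> ends G f}"
      using rb re by blast
    then have "degree (edges G - ?B) r = degree F r" unfolding F' degree_def by simp
    ultimately have "?B \<in> \<C>" using BB' rF by (simp add: \<C>_def)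
    moreover have "\<forall>i<j. t ?B i = t B i" using swap(1,2) by (simp add: t_def)
    ultimately have "t B j \<le> t ?B j" using lex j by blast
    moreover have "t ?B j = card (incident F (Z j) - {e})"
      using swap(1)[of j] swap(3) by (simp add: t_def F_def Z_def)
    moreover have "card (incident F (Z j) - {e}) < card (incident F (Z j))"
      using finF e by (intro card_Diff1_less) (simp_all add: incident_def)
    ultimately show False by (simp add: t_def F_def Z_def)
  qed
  \<comment> \<open>The summand \<open>k\<close> comes from the covered vertex \<open>r\<close>, which starts the layers without any free vertex.\<close>
  have count: "card (Z j \<inter> I) + k \<le> k * card (Z j - I)" if "j \<le> card (verts G)" for j
    using that
  proof (induction j)
    case 0
    then show ?case using rI by (simp add: Z_def insert_Diff_if)
  next
    case (Suc j)
    let ?W = "Z j \<union> \<Union>(ends G ` incident F (Z j))"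
    have ZZ: "Z j \<subseteq> Z (Suc j)" unfolding Z_def by (rule layer_mono) simp
    have fin: "finite (Z i)" for i by (rule tight_finite[OF Zt])
    have "I \<inter> ?W \<subseteq> Z j" by (auto simp: I_def incident_def)
    then have new: "card ((Z (Suc j) - Z j) \<inter> I) \<le> k * card (Z (Suc j) - Z j - I)"
      using Suc.prems indep[of j]
      by (intro card_independent_in_hull[OF spB Zt Zt Zs]) auto
    have "Z (Suc j) \<inter> I = (Z j \<inter> I) \<union> ((Z (Suc j) - Z j) \<inter> I)"
      "Z (Suc j) - I = (Z j - I) \<union> (Z (Suc j) - Z j - I)" using ZZ by blast+
    moreover have "card ((Z j \<inter> I) \<union> ((Z (Suc j) - Z j) \<inter> I)) = card (Z j \<inter> I) + card ((Z (Suc j) - Z j) \<inter> I)"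
      using fin by (intro card_Un_disjoint) auto
    moreover have "card ((Z j - I) \<union> (Z (Suc j) - Z j - I)) = card (Z j - I) + card (Z (Suc j) - Z j - I)"
      using fin by (intro card_Un_disjoint) auto
    ultimately show ?case using new Suc by (simp add: distrib_left)
  qed
  obtain j where j: "j \<le> card (verts G)" "Z (Suc j) = Z j"
    using increasing_chain_stabilises[OF finite_verts, of Z] layer_mono[of _ "Suc _" k B r] ZV by (auto simp: Z_def)
  let ?X = "Z j"
  let ?m = "card (induced F ?X)"
  have finX: "finite ?X" by (rule tight_finite[OF Zt])
  have closed: "incident F ?X \<subseteq> induced F ?X"
  proof
    fix e assume e: "e \<in> incident F ?X"
    then have "ends G e \<subseteq> Z (Suc j)"
      using incident_subset_expand[of e B ?X k] by (simp add: Z_def F_def)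
    then show "e \<in> induced F ?X" using e j(2) by (simp add: incident_def induced_def)
  qed
  have "?X - I \<subseteq> (\<Union>e\<in>induced F ?X. ends G e)"
    using closed unfolding I_def incident_def by blast
  moreover have "finite (\<Union>e\<in>induced F ?X. ends G e)"
    by (rule finite_UN_I[OF finite_induced[OF finF]]) (auto simp: induced_def F_def intro: finite_ends)
  ultimately have "card (?X - I) \<le> card (\<Union>e\<in>induced F ?X. ends G e)"
    by (rule card_mono[rotated])
  also have "\<dots> \<le> (\<Sum>e\<in>induced F ?X. card (ends G e))"
    by (rule card_UN_le[OF finite_induced[OF finF]])
  also have "\<dots> \<le> (\<Sum>e\<in>induced F ?X. 2)"
    using card_ends by (intro sum_mono) (fastforce simp: induced_def F_def)
  finally have c: "card (?X - I) \<le> 2 * ?m" by simp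
  have i: "card (?X \<inter> I) + k \<le> k * card (?X - I)" using count j by simp
  have X: "card ?X = card (?X \<inter> I) + card (?X - I)" using finX by (simp add: card_Int_Diff)
  have "induced (edges G) ?X = induced B ?X \<union> induced F ?X"
    using sparse_subset_edges[OF spB] by (auto simp: induced_def F_def)
  moreover have "induced B ?X \<inter> induced F ?X = {}" by (auto simp: induced_def F_def)
  ultimately have E: "card (induced (edges G) ?X) = card (induced B ?X) + ?m"
    using finite_induced[OF finF] finite_induced[OF sparse_finite[OF spB]]
    by (simp add: card_Un_disjoint)
  have "card (induced B ?X) + k = k * card ?X" using Zt by (simp add: tight_def)
  then have "(3 * k + 2) * (card (induced B ?X) + k) = (3 * k + 2) * (k * card ?X)"
    by (rule arg_cong)
  moreover have "(3 * k + 2) * (card (induced B ?X) + ?m) + (k * (3 * k + 2) + 1) \<le> (k * (3 * k + 2) + 1) * card ?X"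
    using dens[OF ZV, of j] Zt[of j] by (simp add: E tight_def)
  ultimately have "(3 * k + 2) * ?m + 1 \<le> card ?X"
    by (simp add: algebra_simps)
  moreover have "k * card (?X - I) \<le> k * (2 * ?m)" using c by simp
  ultimately show False using c i X by (simp add: algebra_simps)
qed

lemma density_bound:
  assumes "fractional_arboricity G \<le> ereal (real k + 1 / (3 * real k + 2))"
    and X: "X \<subseteq> verts G" "X \<noteq> {}"
  shows "(3 * k + 2) * card (induced (edges G) X) + (k * (3 * k + 2) + 1) \<le> (k * (3 * k + 2) + 1) * card X"
proof -
  let ?H = "\<lparr>verts = X, edges = induced (edges G) X, ends = ends G\<rparr>"
  have fin: "finite X" using X(1) finite_verts by (rule finite_subset)
  have "finite_multigraph ?H"
    using fin finite_induced[OF finite_edges] card_ends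
    by unfold_locales (auto simp: induced_def)
  then have "subgraph ?H G" using X by (auto simp: subgraph_def induced_def)
  moreover have "finite {H. subgraph H G}"
    by (rule finite_subgraphs) (rule finite_multigraph_axioms)
  ultimately have "density ?H \<le> fractional_arboricity G"
    unfolding fractional_arboricity_def by (intro Max_ge) auto
  then have d: "density ?H \<le> ereal (real k + 1 / (3 * real k + 2))" using assms(1) by (rule order_trans)
  have c: "1 \<le> card X" using X fin by (simp add: Suc_le_eq card_gt_0_iff)
  show ?thesis
  proof (cases "card X = 1")
    case True
    then have "induced (edges G) X = {}" using d by (auto simp: density_def split: if_splits)
    then show ?thesis using True by simp
  next
    case False
    then have c2: "1 < real (card X)" using c by simp
    then have "real (card (induced (edges G) X)) / (real (card X) - 1) \<le> real k + 1 / (3 * real k + 2)"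
      using d by (simp add: density_def)
    then have "real (card (induced (edges G) X)) \<le> (real k + 1 / (3 * real k + 2)) * (real (card X) - 1)"
      using c2 by (simp add: divide_le_eq)
    then have "(3 * real k + 2) * real (card (induced (edges G) X)) \<le>
        (3 * real k + 2) * ((real k + 1 / (3 * real k + 2)) * (real (card X) - 1))"
      by (intro mult_left_mono) auto
    also have "\<dots> = ((3 * real k + 2) * (real k + 1 / (3 * real k + 2))) * (real (card X) - 1)"
      by (simp only: mult.assoc)
    also have "(3 * real k + 2) * (real k + 1 / (3 * real k + 2)) = real k * (3 * real k + 2) + 1"
      by (simp add: distrib_left) (simp add: algebra_simps)
    finally have "real ((3 * k + 2) * card (induced (edges G) X) + (k * (3 * k + 2) + 1))
        \<le> real ((k * (3 * k + 2) + 1) * card X)"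
      by (simp add: algebra_simps)
    then show ?thesis by (simp only: of_nat_le_iff)
  qed
qed

end

theorem theorem5:
  fixes G :: "('v, 'e) multigraph" and k :: nat
  assumes "k \<ge> 1"
    and "finite_multigraph G"
    and "fractional_arboricity G \<le> ereal (real k + 1 / (3 * real k + 2))"
  shows "\<exists>(F :: nat \<Rightarrow> 'e set) (M :: 'e set).
    (\<forall>i\<in>{1..k}. forest_edge_set G (F i)) \<and>
    matching G M \<and>
    (\<Union>i\<in>{1..k}. F i) \<union> M = edges G \<and>
    disjoint_family_on F {1..k} \<and>
    (\<forall>i\<in>{1..k}. F i \<inter> M = {})"
proof -
  interpret finite_multigraph G by fact
  note dens = density_bound[OF assms(3)]
  obtain B where B: "sparse k B" "\<And>v. degree (edges G - B) v \<le> 1"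
    using sparse_with_matching_complement[OF dens] by blast
  obtain F where F: "forest_partition k B F"
    using sparse_imp_forest_partition[OF B(1)] by blast
  let ?M = "edges G - B"
  have "card (ends G e) \<noteq> 1" if e: "e \<in> edges G" for e
  proof
    assume 1: "card (ends G e) = 1"
    have "e \<in> induced (edges G) (ends G e)" using e by (simp add: induced_def)
    then have "card (induced (edges G) (ends G e)) \<noteq> 0"
      using finite_induced[OF finite_edges] by auto
    then show False using dens[OF ends_subset[OF e] ends_nonempty[OF e]] 1 by simp
  qed
  moreover have "ends G e \<inter> ends G f = {}" if ef: "e \<in> ?M" "f \<in> ?M" "e \<noteq> f" for e f
  proof (rule ccontr)
    assume "ends G e \<inter> ends G f \<noteq> {}"
    then obtain v where v: "v \<in> ends G e" "v \<in> ends G f" by blast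
    have "card {e, f} \<le> degree ?M v"
      unfolding degree_def using ef v finite_edges by (intro card_mono) auto
    then show False using B(2)[of v] ef(3) by simp
  qed
  ultimately have "matching G ?M" by (simp add: matching_def)
  moreover have "(\<Union>i\<in>{1..k}. F i) = B" using F by (simp add: forest_partition_def)
  then have "(\<Union>i\<in>{1..k}. F i) \<union> ?M = edges G" "\<forall>i\<in>{1..k}. F i \<inter> ?M = {}"
    using sparse_subset_edges[OF B(1)] by blast+
  moreover have "\<forall>i\<in>{1..k}. forest_edge_set G (F i)" "disjoint_family_on F {1..k}"
    using F sparse_1_imp_forest_edge_set by (auto simp: forest_partition_def)
  ultimately show ?thesis by blast
qed

end
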